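(* Let $n\ge 1$ be an integer and $0<p<1$. For any integer $k\ge 1$, the $k$-th order generalized Zagreb index $Z_n^{(k)}$ of $G(n,p)$ can be expressed as $$Z_{n}^{(k)}=\sum_{m=1}^k m!\,\genfrac\{\}{0pt}{}{k}{m}\,S_{m+1,n},$$ where $S_{m+1,n}$ is the number of $(m+1)$-stars in $G(n,p)$.
   Context: $G(n,p)$ is the Erdős–Rényi random graph on the vertex set $\{1,\dots,n\}$, in which each possible edge is present independently with probability $p$. $I_{ij}$ is the indicator of the event that there is an edge between $i$ and $j$; so $I_{ii}=0$, $I_{ij}=I_{ji}$, and $\{I_{ij}:1\le i<j\le n\}$ are independent Bernoulli variables with success probability $p$. For an integer $k\ge1$, the $k$-th order generalized Zagreb index is $Z_n^{(k)}=\sum_{i=1}^n\big(\sum_{j=1}^n I_{ij}\big)^k$. For $m\ge 2$, an $m$-star is a tree on $m$ vertices with one vertex (the center) of degree $m-1$ and the others of degree 1; two 2-stars on the same pair of vertices but with different centers are counted as distinct. The number of $m$-stars with center $i$ is $S_{m,n}^{(i)}=\sum_{1\le j_1<\cdots<j_{m-1}\le n}I_{ij_1}\cdots I_{ij_{m-1}}$, and the number of $m$-stars in $G(n,p)$ is $S_{m,n}=\sum_{i=1}^n S_{m,n}^{(i)}$. $\genfrac\{\}{0pt}{}{k}{m}$ denotes the Stirling number of the second kind (the number of partitions of a set of $k$ elements into $m$ nonempty classes). *)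

theory Defs
  imports "HOL-Probability.Probability" "HOL-Combinatorics.Stirling"
begin

definition pairs_of :: "'a set \<Rightarrow> 'a set set" where
  "pairs_of V = {e. e \<subseteq> V \<and> card e = 2}"

text \<open>
  The Erdos--Renyi random graph, given by its random edge set \<open>G\<close> on an arbitrary probability
  space. The library's \<open>indep_events\<close> includes measurability of the events.
\<close>

locale erdos_renyi = prob_space M for M :: "'w measure" +
  fixes n :: nat and p :: real and G :: "'w \<Rightarrow> nat set set"
  assumes edges_subset: "\<And>\<omega>. \<omega> \<in> space M \<Longrightarrow> G \<omega> \<subseteq> pairs_of {1..n}"
    and edges_indep: "indep_events (\<lambda>e. {\<omega> \<in> space M. e \<in> G \<omega>}) (pairs_of {1..n})"
    and edges_prob: "\<And>e. e \<in> pairs_of {1..n} \<Longrightarrow> prob {\<omega> \<in> space M. e \<in> G \<omega>} = p"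

text \<open>On the diagonal this is 0, since the singleton \<open>{i, i}\<close> is never an edge.\<close>

definition edge_ind :: "('w \<Rightarrow> nat set set) \<Rightarrow> nat \<Rightarrow> nat \<Rightarrow> 'w \<Rightarrow> nat" where
  "edge_ind G i j \<omega> = of_bool ({i, j} \<in> G \<omega>)"

definition zagreb :: "('w \<Rightarrow> nat set set) \<Rightarrow> nat \<Rightarrow> nat \<Rightarrow> 'w \<Rightarrow> nat" where
  "zagreb G n k \<omega> = (\<Sum>i=1..n. (\<Sum>j=1..n. edge_ind G i j \<omega>) ^ k)"

text \<open>The lists of length \<open>r\<close> representing index tuples \<open>1 \<le> j\<^sub>1 < \<dots> < j\<^sub>r \<le> n\<close>.\<close>

definition incr_tuples :: "nat \<Rightarrow> nat \<Rightarrow> nat list set" where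
  "incr_tuples r n = {js. length js = r \<and> sorted_wrt (<) js \<and> set js \<subseteq> {1..n}}"

definition star_count_at :: "('w \<Rightarrow> nat set set) \<Rightarrow> nat \<Rightarrow> nat \<Rightarrow> nat \<Rightarrow> 'w \<Rightarrow> nat" where
  "star_count_at G m n i \<omega> = (\<Sum>js\<in>incr_tuples (m - 1) n. \<Prod>j\<leftarrow>js. edge_ind G i j \<omega>)"

definition star_count :: "('w \<Rightarrow> nat set set) \<Rightarrow> nat \<Rightarrow> nat \<Rightarrow> 'w \<Rightarrow> nat" where
  "star_count G m n \<omega> = (\<Sum>i=1..n. star_count_at G m n i \<omega>)"

text \<open>
  The remainder is not used in the definitions above. It shows that \<open>star_count\<close> is the number
  of stars that are subgraphs of the random graph, a star being recorded together with its center.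
\<close>

definition connected_graph :: "'a set \<Rightarrow> 'a set set \<Rightarrow> bool" where
  "connected_graph V T \<longleftrightarrow> (\<forall>u\<in>V. \<forall>v\<in>V. (u, v) \<in> {(x, y). {x, y} \<in> T}\<^sup>*)"

definition has_cycle :: "'a set set \<Rightarrow> bool" where
  "has_cycle T \<longleftrightarrow> (\<exists>xs. length xs \<ge> 3 \<and> distinct xs \<and>
     (\<forall>i<length xs. {xs ! i, xs ! (Suc i mod length xs)} \<in> T))"

definition is_tree :: "'a set \<Rightarrow> 'a set set \<Rightarrow> bool" where
  "is_tree V T \<longleftrightarrow> finite V \<and> V \<noteq> {} \<and> T \<subseteq> pairs_of V \<and> connected_graph V T \<and> \<not> has_cycle T"

definition degree_in :: "'a set set \<Rightarrow> 'a \<Rightarrow> nat" where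
  "degree_in T v = card {e \<in> T. v \<in> e}"

definition is_star :: "nat \<Rightarrow> 'a \<Rightarrow> 'a set \<Rightarrow> 'a set set \<Rightarrow> bool" where
  "is_star m c V T \<longleftrightarrow> is_tree V T \<and> card V = m \<and> c \<in> V \<and>
     degree_in T c = m - 1 \<and> (\<forall>v\<in>V - {c}. degree_in T v = 1)"

lemma pairs_of_containing:
  "{e \<in> pairs_of V. c \<in> e} = (\<lambda>j. {c, j}) ` (V - {c})" if "c \<in> V" for V :: "'a set"
  using that by (fastforce simp: pairs_of_def card_2_iff doubleton_eq_iff)

lemma inj_pair: "inj_on (\<lambda>j. {c, j}) A"
  by (auto simp: inj_on_def doubleton_eq_iff)

lemma no_cycle_star: "\<not> has_cycle ((\<lambda>j. {c, j}) ` A)"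
proof
  assume "has_cycle ((\<lambda>j. {c, j}) ` A)"
  then obtain xs where l: "length xs \<ge> 3" and d: "distinct xs"
    and e: "\<And>i. i < length xs \<Longrightarrow> {xs ! i, xs ! (Suc i mod length xs)} \<in> (\<lambda>j. {c, j}) ` A"
    unfolding has_cycle_def by blast
  have c: "c = xs ! i \<or> c = xs ! (Suc i mod length xs)" if "i < length xs" for i
    using e[OF that] by (auto simp: doubleton_eq_iff)
  have ne: "xs ! i \<noteq> xs ! j" if "i < length xs" "j < length xs" "i \<noteq> j" for i j
    using d that by (simp add: nth_eq_iff_index_eq)
  have "c = xs ! 0 \<or> c = xs ! 1" using c[of 0] l by (cases "xs = []") auto
  moreover have "c = xs ! 1 \<or> c = xs ! 2" using c[of 1] l by (simp add: numeral_2_eq_2)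
  moreover have "xs ! 0 \<noteq> xs ! 2" by (rule ne) (use l in auto)
  ultimately have c1: "c = xs ! 1" by metis
  have "Suc 2 mod length xs \<noteq> 1"
    using l by (cases "length xs = 3") auto
  moreover have "Suc 2 mod length xs < length xs" using l by (intro mod_less_divisor) auto
  ultimately have "c \<noteq> xs ! (Suc 2 mod length xs)"
    unfolding c1 by (intro ne) (use l in auto)
  moreover have "c \<noteq> xs ! 2" unfolding c1 by (rule ne) (use l in auto)
  ultimately show False using c[of 2] l by linarith
qed

lemma is_star_iff:
  assumes "m \<ge> 2"
  shows "is_star m c V T \<longleftrightarrow>
    finite V \<and> card V = m \<and> c \<in> V \<and> T = (\<lambda>j. {c, j}) ` (V - {c})"
proof
  assume s: "is_star m c V T"
  then have fin: "finite V" and cV: "card V = m" "c \<in> V" and T: "T \<subseteq> pairs_of V"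
    and deg: "degree_in T c = m - 1" and deg1: "\<And>v. v \<in> V - {c} \<Longrightarrow> degree_in T v = 1"
    by (auto simp: is_star_def is_tree_def)
  let ?S = "(\<lambda>j. {c, j}) ` (V - {c})"
  have sub: "{e \<in> T. c \<in> e} \<subseteq> ?S"
    using pairs_of_containing[OF cV(2)] T by blast
  have "card ?S = m - 1"
    using cV fin by (subst card_image[OF inj_pair]) simp
  then have eq: "{e \<in> T. c \<in> e} = ?S"
    using sub deg fin by (intro card_subset_eq) (auto simp: degree_in_def)
  have "e \<in> ?S" if e: "e \<in> T" for e
  proof (cases "c \<in> e")
    case False
    have e2: "e \<subseteq> V" "card e = 2" using T e by (auto simp: pairs_of_def)
    then obtain v where v: "v \<in> e" by force
    then have vV: "v \<in> V - {c}" using e2 False by auto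
    then have "{c, v} \<in> T" using eq by blast
    then have "{e, {c, v}} \<subseteq> {e \<in> T. v \<in> e}" using v e by auto
    moreover have "finite {e \<in> T. v \<in> e}"
      using deg1[OF vV] by (auto simp: degree_in_def intro: card_ge_0_finite)
    ultimately have "card {e, {c, v}} \<le> 1"
      using deg1[OF vV] card_mono unfolding degree_in_def by metis
    moreover have "e \<noteq> {c, v}" using False by auto
    ultimately show ?thesis by simp
  qed (use e eq in blast)
  then show "finite V \<and> card V = m \<and> c \<in> V \<and> T = ?S"
    using fin cV eq by blast
next
  assume "finite V \<and> card V = m \<and> c \<in> V \<and> T = (\<lambda>j. {c, j}) ` (V - {c})"
  then have fin: "finite V" and cV: "card V = m" "c \<in> V"
    and T: "T = (\<lambda>j. {c, j}) ` (V - {c})" by auto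
  let ?R = "{(x, y). {x, y} \<in> T}"
  have up: "(u, c) \<in> ?R\<^sup>*" "(c, u) \<in> ?R\<^sup>*" if "u \<in> V" for u
  proof -
    have "u \<noteq> c \<Longrightarrow> (u, c) \<in> ?R \<and> (c, u) \<in> ?R"
      using that T by (auto simp: insert_commute)
    then show "(u, c) \<in> ?R\<^sup>*" "(c, u) \<in> ?R\<^sup>*" by (cases "u = c"; blast)+
  qed
  have "connected_graph V T"
    unfolding connected_graph_def using up by (blast intro: rtrancl_trans)
  moreover have "T \<subseteq> pairs_of V"
    using T cV pairs_of_containing[OF cV(2)] by auto
  ultimately have tree: "is_tree V T"
    using fin cV no_cycle_star[of c "V - {c}"] T by (auto simp: is_tree_def)
  have "{e \<in> T. c \<in> e} = T" using T by auto
  then have "degree_in T c = card V - 1"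
    unfolding degree_in_def using T fin cV card_image[OF inj_pair] by (metis card_Diff_singleton)
  moreover have "degree_in T v = 1" if "v \<in> V - {c}" for v
  proof -
    have "{e \<in> T. v \<in> e} = {{c, v}}" using T that by auto
    then show ?thesis by (simp add: degree_in_def)
  qed
  ultimately show "is_star m c V T" using tree cV by (auto simp: is_star_def)
qed

lemma finite_incr_tuples: "finite (incr_tuples r n)"
  unfolding incr_tuples_def
  by (rule finite_subset[OF _ finite_lists_length_eq[of "{1..n}" r]]) auto

lemma star_count_at_eq_card:
  "star_count_at G m n i \<omega> = card {js \<in> incr_tuples (m - 1) n. \<forall>j\<in>set js. {i, j} \<in> G \<omega>}"
proof -
  have "(\<Prod>j\<leftarrow>js. edge_ind G i j \<omega>) = of_bool (\<forall>j\<in>set js. {i, j} \<in> G \<omega>)" for js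
    by (induction js) (auto simp: edge_ind_def)
  then show ?thesis
    unfolding star_count_at_def by (simp add: finite_incr_tuples Int_def)
qed

lemma star_count_eq_card_stars:
  assumes m: "m \<ge> 2" and G: "G \<omega> \<subseteq> pairs_of {1..n}"
  shows "star_count G m n \<omega> = card {(c, V, T). is_star m c V T \<and> V \<subseteq> {1..n} \<and> T \<subseteq> G \<omega>}"
proof -
  let ?A = "\<lambda>i. {js \<in> incr_tuples (m - 1) n. \<forall>j\<in>set js. {i, j} \<in> G \<omega>}"
  let ?f = "\<lambda>(c, js). (c, insert c (set js), (\<lambda>j. {c, j}) ` set js)"
  let ?B = "{(c, V, T). is_star m c V T \<and> V \<subseteq> {1..n} \<and> T \<subseteq> G \<omega>}"
  have nc: "c \<notin> set js" if "js \<in> ?A c" for c js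
    using that G by (fastforce simp: pairs_of_def)
  have "star_count G m n \<omega> = card (Sigma {1..n} ?A)"
    unfolding star_count_def
    by (simp add: star_count_at_eq_card finite_incr_tuples)
  moreover have "bij_betw ?f (Sigma {1..n} ?A) ?B"
  proof (rule bij_betwI')
    fix x y assume "x \<in> Sigma {1..n} ?A" "y \<in> Sigma {1..n} ?A"
    then obtain c js d ks where [simp]: "x = (c, js)" "y = (d, ks)"
      and a: "js \<in> ?A c" "ks \<in> ?A d" by blast
    have "js = ks" if "c = d" "insert c (set js) = insert c (set ks)"
    proof -
      have "set js = set ks" using nc[OF a(1)] nc[OF a(2)] that by auto
      then show ?thesis
        using a by (auto simp: incr_tuples_def intro: sorted_distinct_set_unique
          simp: strict_sorted_iff)
    qed
    then show "?f x = ?f y \<longleftrightarrow> x = y" by auto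
  next
    fix x assume "x \<in> Sigma {1..n} ?A"
    then obtain c js where [simp]: "x = (c, js)" and c: "c \<in> {1..n}" and a: "js \<in> ?A c" by blast
    have "card (set js) = m - 1"
      using a by (auto simp: incr_tuples_def strict_sorted_iff distinct_card)
    then have "is_star m c (insert c (set js)) ((\<lambda>j. {c, j}) ` set js)"
      unfolding is_star_iff[OF m] using nc[OF a] m by auto
    then show "?f x \<in> ?B" using a c by (auto simp: incr_tuples_def)
  next
    fix y assume "y \<in> ?B"
    then obtain c V T where [simp]: "y = (c, V, T)" and s: "is_star m c V T"
      and V: "V \<subseteq> {1..n}" and T: "T \<subseteq> G \<omega>" by blast
    let ?js = "sorted_list_of_set (V - {c})"
    have *: "finite V" "card V = m" "c \<in> V" "T = (\<lambda>j. {c, j}) ` (V - {c})"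
      using s unfolding is_star_iff[OF m] by auto
    have set: "set ?js = V - {c}" using * by simp
    have "?js \<in> ?A c"
      unfolding incr_tuples_def using * V T set by auto
    moreover have "y = ?f (c, ?js)"
      using * set by (simp add: insert_absorb)
    ultimately show "\<exists>x\<in>Sigma {1..n} ?A. y = ?f x"
      using * V by (intro bexI[of _ "(c, ?js)"]) auto
  qed
  then have "card (Sigma {1..n} ?A) = card ?B" by (rule bij_betw_same_card)
  ultimately show ?thesis by simp
qed

end

theory Submission
  imports Defs
begin

text \<open>
  The star count at \<open>i\<close> is \<open>d choose m\<close> for \<open>d\<close> the degree of \<open>i\<close>, so the identity holds vertex by
  vertex, as the expansion of \<open>d ^ k\<close> in falling factorials.
\<close>

text \<open>Write \<open>d = m + (d - m)\<close> and absorb \<open>d - m\<close> into the next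
  binomial coefficient. When \<open>m\<close> exceeds \<open>d\<close> the subtraction truncates,
  but both coefficients vanish.\<close>

lemma mult_binomial_eq: "d * (d choose m) = m * (d choose m) + Suc m * (d choose Suc m)"
proof (cases "m \<le> d")
  case True
  have "Suc m * (d choose Suc m) = (d - m) * (d choose m)"
    by (simp only: binomial_absorption binomial_absorb_comp)
  then show ?thesis
    using True by (simp flip: add_mult_distrib)
qed (simp add: binomial_eq_0)

text \<open>Induction on \<open>k\<close>: multiplying by \<open>d\<close> splits each term between
  the indices \<open>m\<close> and \<open>Suc m\<close>, and the Stirling recurrence merges the two
  contributions.\<close>

lemma power_eq_sum_Stirling: "d ^ k = (\<Sum>m\<le>k. fact m * Stirling k m * (d choose m))"
  for d k :: nat
proof (induction k)
  case 0
  then show ?case by simp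
next
  case (Suc k)
  let ?c = "\<lambda>m. fact m * Stirling k m * (d choose m) :: nat"
  have "d ^ Suc k = (\<Sum>m\<le>k. fact m * Stirling k m * (d * (d choose m)))"
    by (simp add: Suc.IH sum_distrib_left mult_ac)
  also have "\<dots> = (\<Sum>m\<le>k. m * ?c m)
      + (\<Sum>m\<le>k. fact (Suc m) * Stirling k m * (d choose Suc m))"
    by (subst mult_binomial_eq) (simp add: algebra_simps sum.distrib)
  \<comment> \<open>The added top term is zero because \<open>Stirling k (Suc k) = 0\<close>; the
    padding lets the shift below, whose \<open>m = 0\<close> term is zero, end at \<open>k\<close>
    again.\<close>
  also have "(\<Sum>m\<le>k. m * ?c m) = (\<Sum>m\<le>Suc k. m * ?c m)"
    by simp
  also have "\<dots> = (\<Sum>m\<le>k. Suc m * ?c (Suc m))"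
    by (subst sum.atMost_Suc_shift) simp
  also have "\<dots> + (\<Sum>m\<le>k. fact (Suc m) * Stirling k m * (d choose Suc m))
      = (\<Sum>m\<le>k. fact (Suc m) * Stirling (Suc k) (Suc m) * (d choose Suc m))"
    by (simp add: algebra_simps flip: sum.distrib)
  \<comment> \<open>The new term at \<open>m = 0\<close> vanishes, as
    \<open>Stirling (Suc k) 0 = 0\<close>.\<close>
  also have "\<dots> = (\<Sum>m\<le>Suc k. fact m * Stirling (Suc k) m * (d choose m))"
    by (subst sum.atMost_Suc_shift) simp
  finally show ?case .
qed

text \<open>A strictly increasing list is determined by its set of entries, so such lists correspond
  to the \<open>r\<close>-element subsets of \<open>A\<close>.\<close>

lemma card_strict_sorted_lists:
  fixes A :: "'a::linorder set"
  assumes "finite A"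
  shows "card {xs. length xs = r \<and> sorted_wrt (<) xs \<and> set xs \<subseteq> A} = card A choose r"
proof -
  have "bij_betw set {xs. length xs = r \<and> sorted_wrt (<) xs \<and> set xs \<subseteq> A}
      {B. B \<subseteq> A \<and> card B = r}"
  proof (rule bij_betw_byWitness[where f' = sorted_list_of_set])
    show "set ` {xs. length xs = r \<and> sorted_wrt (<) xs \<and> set xs \<subseteq> A} \<subseteq> {B. B \<subseteq> A \<and> card B = r}"
      by (auto simp: strict_sorted_iff distinct_card)
  qed (use assms in \<open>auto simp: strict_sorted_iff sorted_list_of_set.idem_if_sorted_distinct
      dest: finite_subset[THEN set_sorted_list_of_set]\<close>)
  then show ?thesis
    by (simp add: bij_betw_same_card n_subsets[OF assms])
qed

text \<open>A tuple counts exactly when all its entries are neighbours of \<open>i\<close>, so a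
  star amounts to an \<open>m\<close>-subset of the neighbourhood \<open>?N\<close>.\<close>

lemma star_count_at_eq_binomial:
  "star_count_at G (Suc m) n i \<omega> = ((\<Sum>j=1..n. edge_ind G i j \<omega>) choose m)"
proof -
  let ?N = "{j \<in> {1..n}. {i, j} \<in> G \<omega>}"
  have "{js \<in> incr_tuples m n. \<forall>j\<in>set js. {i, j} \<in> G \<omega>}
      = {js. length js = m \<and> sorted_wrt (<) js \<and> set js \<subseteq> ?N}"
    by (auto simp: incr_tuples_def)
  moreover have "(\<Sum>j=1..n. edge_ind G i j \<omega>) = card ?N"
    by (simp add: edge_ind_def Int_def)
  ultimately show ?thesis
    by (simp add: star_count_at_eq_card card_strict_sorted_lists)
qed

theorem proposition1:
  fixes M :: "'w measure" and n k :: nat and p :: real and G :: "'w \<Rightarrow> nat set set"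
  assumes "n \<ge> 1" and "0 < p" and "p < 1"
    and "erdos_renyi M n p G"
    and "k \<ge> 1"
  shows "\<forall>\<omega>\<in>space M.
    zagreb G n k \<omega> = (\<Sum>m=1..k. fact m * Stirling k m * star_count G (m + 1) n \<omega>)"
proof
  fix \<omega>
  let ?d = "\<lambda>i. \<Sum>j=1..n. edge_ind G i j \<omega>"
  \<comment> \<open>The sum may start at 1 since \<open>Stirling k 0 = 0\<close> for positive
    \<open>k\<close>.\<close>
  have "?d i ^ k = (\<Sum>m=1..k. fact m * Stirling k m * (?d i choose m))" for i
    unfolding power_eq_sum_Stirling using \<open>k \<ge> 1\<close>
    by (cases k) (simp_all add: atMost_atLeast0 sum.atLeast_Suc_atMost)
  then have "zagreb G n k \<omega> = (\<Sum>i=1..n. \<Sum>m=1..k. fact m * Stirling k m * (?d i choose m))"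
    by (simp add: zagreb_def)
  also have "\<dots> = (\<Sum>m=1..k. \<Sum>i=1..n. fact m * Stirling k m * (?d i choose m))"
    by (rule sum.swap)
  also have "\<dots> = (\<Sum>m=1..k. fact m * Stirling k m * star_count G (m + 1) n \<omega>)"
    by (simp add: star_count_def star_count_at_eq_binomial sum_distrib_left)
  finally show "zagreb G n k \<omega> = (\<Sum>m=1..k. fact m * Stirling k m * star_count G (m + 1) n \<omega>)" .
qed

end
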